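(* Let $n_0\in\mathbb{N}$ and let $(T_n(x))_{n\ge n_0}$ be real polynomials satisfying, for $n\ge n_0$, $$T_{n+1}(x)=(\alpha_n x^2+\beta_n x+\gamma_n)T_n(x)+(\mu_n x^3+\varphi_n x)\,\frac{d}{dx}T_n(x),$$ where $\alpha_n,\beta_n,\gamma_n,\mu_n,\varphi_n$ are real sequences with $\beta_n,\gamma_n,\varphi_n\ge 0$ for all $n$. Assume that $T_{n_0}(x)$ is Hurwitz stable. If one of the following holds (for all $n \ge n_0$): (1) $\deg(T_n(x))=n$ and $\alpha_n=-n\mu_n\ge 0$; (2) $\deg(T_n(x))=m_n$ with $m_n\ne n$, and $\alpha_n\ge -m_n\mu_n\ge 0$; then $T_n(x)$ is Hurwitz stable for all $n\ge n_0$.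
   Context: A polynomial $f\in\mathbb{C}[x]$ is Hurwitz stable if it is identically zero or $f(x)\ne 0$ whenever $\Re(x)>0$. *)

theory Defs
  imports Complex_Main "HOL-Computational_Algebra.Polynomial"
begin

definition hurwitz_stable :: "complex poly \<Rightarrow> bool" where
  "hurwitz_stable f \<longleftrightarrow> f = 0 \<or> (\<forall>x. Re x > 0 \<longrightarrow> poly f x \<noteq> 0)"

end

theory Submission
  imports Defs "HOL-Computational_Algebra.Computational_Algebra"
begin

text \<open>
  Write $T_n = c \prod_i (x - r_i)$ with $\mathrm{Re}\, r_i \le 0$ and let
  $d = \deg T_n$. Dividing the recurrence by $x T_n$ gives
  \[ \frac{T_{n+1}}{x T_n} = (\alpha_n + d \mu_n) x + \beta_n + \frac{\gamma_n}{x}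
      + \mu_n \sum_i \frac{x r_i}{x - r_i} + \varphi_n \sum_i \frac{1}{x - r_i}. \]
  For $\mathrm{Re}\, x > 0$ every summand has nonnegative real part: for $r_i \ne 0$,
  $x r_i / (x - r_i)$ is the inverse of $1/r_i - 1/x$, whose real part is negative, and
  $\mu_n \le 0$ unless $d = 0$. So $T_{n+1}$ can vanish at $x$ only if all the real parts
  vanish, and then $T_{n+1}$ is the zero polynomial.
\<close>

section \<open>Inversion and the right half-plane\<close>

lemma Re_divide_one_pos_iff: "Re (1 / z) > 0 \<longleftrightarrow> Re z > 0"
proof (cases "z = 0")
  case False
  then have "(Re z)\<^sup>2 + (Im z)\<^sup>2 > 0"
    by (simp add: complex_neq_0)
  then show ?thesis
    by (simp add: Re_divide zero_less_divide_iff)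
qed simp

text \<open>The expression equals \<open>- x * r / (x - r)\<close>, the inverse of
  \<open>1 / x + 1 / - r\<close>. Inversion preserves the open right half-plane, which contains
  \<open>1 / x\<close>, while \<open>1 / - r\<close> has nonnegative real part.\<close>

lemma Re_linear_factor:
  fixes x r :: complex
  assumes "Re r \<le> 0" "Re x > 0" "r \<noteq> 0"
  shows "Re (x - x\<^sup>2 / (x - r)) > 0"
proof -
  have nz: "x \<noteq> 0" "x - r \<noteq> 0" "r - x \<noteq> 0"
    using assms by auto
  have "Re (1 / x) > 0"
    using assms(2) by (simp only: Re_divide_one_pos_iff)
  moreover have "Re (1 / - r) \<ge> 0"
    using assms(1) by (simp add: Re_divide divide_nonpos_nonneg)
  ultimately have "Re (1 / x + 1 / - r) > 0"
    by simp
  then have "Re (1 / (1 / x + 1 / - r)) > 0"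
    by (simp only: Re_divide_one_pos_iff)
  moreover have "1 / (1 / x + 1 / - r) = x - x\<^sup>2 / (x - r)"
    using nz assms(3) by (simp add: divide_simps power2_eq_square algebra_simps)
  ultimately show ?thesis
    by simp
qed

section \<open>Logarithmic derivatives of products of linear factors\<close>

lemma poly_linear_factors_nonzero:
  fixes A :: "'a :: field multiset"
  assumes "x \<notin># A"
  shows "poly (\<Prod>r\<in>#A. [:-r, 1:]) x \<noteq> 0"
  using assms by (induction A) auto

lemma log_deriv_linear_factors:
  fixes A :: "'a :: field_char_0 multiset"
  assumes "x \<notin># A"
  shows "poly (pderiv (\<Prod>r\<in>#A. [:-r, 1:])) x / poly (\<Prod>r\<in>#A. [:-r, 1:]) x
    = (\<Sum>r\<in>#A. 1 / (x - r))"
  using assms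
proof (induction A)
  case (add r A)
  let ?Q = "\<Prod>r\<in>#A. [:-r, 1:]"
  have "poly ?Q x \<noteq> 0"
    using add.prems poly_linear_factors_nonzero[of x A] by simp
  moreover have "x - r \<noteq> 0"
    using add.prems by auto
  moreover have "(\<Prod>r\<in>#add_mset r A. [:-r, 1:]) = [:-r, 1:] * ?Q"
    by simp
  moreover have "pderiv ([:-r, 1:] * ?Q) = [:-r, 1:] * pderiv ?Q + ?Q"
    by (simp add: pderiv_mult pderiv_pCons del: mult_pCons_left)
  ultimately have "poly (pderiv (\<Prod>r\<in>#add_mset r A. [:-r, 1:])) x / poly (\<Prod>r\<in>#add_mset r A. [:-r, 1:]) x
      = 1 / (x - r) + poly (pderiv ?Q) x / poly ?Q x"
    by (simp only: poly_mult poly_add) (simp add: divide_simps)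
  with add show ?case
    by simp
qed (simp add: one_pCons pderiv_pCons)

lemma Re_sum_mset_inverse:
  fixes A :: "complex multiset"
  assumes "\<forall>r\<in>#A. Re r \<le> 0" "Re x > 0"
  shows "Re (\<Sum>r\<in>#A. 1 / (x - r)) \<ge> 0"
    and "A \<noteq> {#} \<Longrightarrow> Re (\<Sum>r\<in>#A. 1 / (x - r)) > 0"
proof -
  have "Re (\<Sum>r\<in>#A. 1 / (x - r)) \<ge> 0 \<and> (A \<noteq> {#} \<longrightarrow> Re (\<Sum>r\<in>#A. 1 / (x - r)) > 0)"
    using assms(1)
  proof (induction A)
    case (add r A)
    have "Re (1 / (x - r)) > 0"
      unfolding Re_divide_one_pos_iff using add.prems assms(2) by simp
    with add show ?case by simp
  qed simp
  then show "Re (\<Sum>r\<in>#A. 1 / (x - r)) \<ge> 0"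
    and "A \<noteq> {#} \<Longrightarrow> Re (\<Sum>r\<in>#A. 1 / (x - r)) > 0"
    by blast+
qed

text \<open>Giving one copy of \<open>x\<close> to each root splits \<open>D\<close> into the terms
  \<open>x - x\<^sup>2 / (x - r)\<close>. A root 0 contributes nothing and any other root a strictly
  positive real part, which settles the equality case.\<close>

lemma Re_sum_mset_defect:
  fixes A :: "complex multiset"
  assumes "\<forall>r\<in>#A. Re r \<le> 0" "Re x > 0"
  defines "D \<equiv> of_nat (size A) * x - x\<^sup>2 * (\<Sum>r\<in>#A. 1 / (x - r))"
  shows "Re D \<ge> 0" and "Re D = 0 \<Longrightarrow> \<forall>r\<in>#A. r = 0"
proof -
  have "Re D \<ge> 0 \<and> (Re D = 0 \<longrightarrow> (\<forall>r\<in>#A. r = 0))"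
    unfolding D_def using assms(1)
  proof (induction A)
    case (add r A)
    let ?D = "\<lambda>A. of_nat (size A) * x - x\<^sup>2 * (\<Sum>r\<in>#A. 1 / (x - r))"
    have D: "Re (?D (add_mset r A)) = Re (x - x\<^sup>2 / (x - r)) + Re (?D A)"
      by (simp add: algebra_simps flip: plus_complex.sel minus_complex.sel)
    have IH: "Re (?D A) \<ge> 0" "Re (?D A) = 0 \<longrightarrow> (\<forall>r\<in>#A. r = 0)"
      using add by auto
    show ?case
    proof (cases "r = 0")
      case True
      then have "x - x\<^sup>2 / (x - r) = 0"
        by (simp add: power2_eq_square)
      with D IH True show ?thesis by (metis add_0 insert_iff set_mset_add_mset_insert zero_complex.sel(1))
    next
      case False
      then have "Re (x - x\<^sup>2 / (x - r)) > 0"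
        using add.prems assms(2) by (intro Re_linear_factor) auto
      with D IH(1) show ?thesis by linarith
    qed
  qed simp
  then show "Re D \<ge> 0" and "Re D = 0 \<Longrightarrow> \<forall>r\<in>#A. r = 0"
    by blast+
qed

lemma hurwitz_stable_log_deriv:
  fixes P :: "complex poly" and x :: complex
  assumes P: "hurwitz_stable P" "P \<noteq> 0" and x: "Re x > 0"
  defines "q \<equiv> poly (pderiv P) x / poly P x"
  defines "D \<equiv> of_nat (degree P) * x - x\<^sup>2 * q"
  shows "Re q \<ge> 0" and "degree P > 0 \<Longrightarrow> Re q > 0" and "Re D \<ge> 0"
    and "Re D = 0 \<Longrightarrow> P = monom (lead_coeff P) (degree P)"
proof -
  obtain A where size_A: "size A = degree P"
    and P_eq: "P = smult (lead_coeff P) (\<Prod>r\<in>#A. [:-r, 1:])"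
    using alg_closed_imp_factorization[OF P(2)] by blast
  define Q where "Q = (\<Prod>r\<in>#A. [:-r, 1:])"
  have P_eq': "P = smult (lead_coeff P) Q"
    using P_eq by (simp add: Q_def)
  have Re_roots: "\<forall>r\<in>#A. Re r \<le> 0"
  proof
    fix r assume "r \<in># A"
    then have "poly Q r = 0"
      by (auto simp: Q_def poly_prod_mset)
    then have "poly P r = 0"
      by (subst P_eq') simp
    with P show "Re r \<le> 0"
      unfolding hurwitz_stable_def using not_less by blast
  qed
  have "x \<notin># A"
    using Re_roots x by force
  \<comment> \<open>The leading coefficient cancels in the logarithmic derivative.\<close>
  have "q = poly (pderiv Q) x / poly Q x"
    unfolding q_def using P(2) by (subst (1 2) P_eq') (simp add: pderiv_smult)
  also have "\<dots> = (\<Sum>r\<in>#A. 1 / (x - r))"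
    unfolding Q_def by (rule log_deriv_linear_factors) fact
  finally have q: "q = (\<Sum>r\<in>#A. 1 / (x - r))" .
  show "Re q \<ge> 0" "degree P > 0 \<Longrightarrow> Re q > 0"
    using Re_sum_mset_inverse[OF Re_roots x] unfolding q size_A[symmetric]
    by (simp_all only: nonempty_has_size)
  show "Re D \<ge> 0"
    using Re_sum_mset_defect(1)[OF Re_roots x] by (simp only: D_def q size_A)
  show "P = monom (lead_coeff P) (degree P)" if "Re D = 0"
  proof -
    have "\<forall>r\<in>#A. r = 0"
      using that unfolding D_def q size_A[symmetric] by (rule Re_sum_mset_defect(2)[OF Re_roots x])
    then have "A = replicate_mset (degree P) 0"
      using size_A by (metis set_mset_subset_singletonD singleton_iff subsetI)
    then have "Q = [:0, 1:] ^ degree P"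
      by (simp add: Q_def)
    then show ?thesis
      using P_eq' by (simp add: monom_altdef)
  qed
qed

section \<open>One step of the recurrence\<close>

lemma hurwitz_stable_step:
  fixes P :: "complex poly" and \<alpha> \<beta> \<gamma> \<mu> \<phi> :: real
  assumes P: "hurwitz_stable P"
    and nonneg: "\<beta> \<ge> 0" "\<gamma> \<ge> 0" "\<phi> \<ge> 0"
    and \<alpha>: "\<alpha> \<ge> - real (degree P) * \<mu>" "- real (degree P) * \<mu> \<ge> 0"
  shows "hurwitz_stable ([:of_real \<gamma>, of_real \<beta>, of_real \<alpha>:] * P
    + [:0, of_real \<phi>, 0, of_real \<mu>:] * pderiv P)" (is "hurwitz_stable ?S")
proof (cases "P = 0")
  case False
  define d where "d = degree P"
  \<comment> \<open>The zero polynomial counts as stable, so it suffices that a single root in the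
    open right half-plane forces \<open>?S\<close> to vanish identically.\<close>
  have "?S = 0" if x: "Re x > 0" and root: "poly ?S x = 0" for x
  proof -
    define q where "q = poly (pderiv P) x / poly P x"
    define D where "D = of_nat d * x - x\<^sup>2 * q"
    note log_deriv = hurwitz_stable_log_deriv[OF P False x, folded q_def d_def, folded D_def]
    have x0: "x \<noteq> 0" using x by auto
    have Px: "poly P x \<noteq> 0"
      using P False x by (auto simp: hurwitz_stable_def)
    have "0 = poly ?S x / (x * poly P x)"
      using root by simp
    \<comment> \<open>After division the cubic coefficient contributes \<mu> times
      \<open>x\<^sup>2 * q = d * x - D\<close>, which moves \<open>d * \<mu>\<close> into the
      coefficient of \<open>x\<close>.\<close>
    also have "\<dots> = of_real (\<alpha> + d * \<mu>) * x + of_real \<beta> + of_real \<gamma> * (1 / x)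
        - of_real \<mu> * D + of_real \<phi> * q"
      using x0 Px by (simp add: D_def q_def field_simps power2_eq_square)
    finally have "Re (of_real (\<alpha> + d * \<mu>) * x + of_real \<beta> + of_real \<gamma> * (1 / x)
        - of_real \<mu> * D + of_real \<phi> * q) = 0"
      by simp
    moreover have Re_mult: "Re (of_real a * z) = a * Re z" for a z
      by simp
    ultimately have sum0: "(\<alpha> + d * \<mu>) * Re x + \<beta> + \<gamma> * Re (1 / x) - \<mu> * Re D + \<phi> * Re q = 0"
      by (simp only: plus_complex.sel minus_complex.sel Re_complex_of_real Re_mult)
    have inv: "Re (1 / x) > 0"
      using x by (simp only: Re_divide_one_pos_iff)
    \<comment> \<open>For constant \<open>P\<close> the hypotheses leave the sign of \<mu> open, so
      the term with \<mu> must vanish by itself.\<close>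
    have D0: "Re D = 0" if "d = 0"
    proof -
      have "pderiv P = 0"
        using that by (simp add: d_def pderiv_eq_0_iff)
      with that show ?thesis by (simp add: D_def q_def)
    qed
    have "- \<mu> * Re D \<ge> 0"
    proof (cases "d = 0")
      case False
      then have "- \<mu> \<ge> 0"
        using \<alpha>(2) by (simp add: d_def mult_le_0_iff)
      then show ?thesis
        using log_deriv(3) by (rule mult_nonneg_nonneg)
    qed (simp add: D0)
    moreover have "(\<alpha> + d * \<mu>) * Re x \<ge> 0"
      using \<alpha>(1) x by (simp add: d_def)
    moreover have "\<gamma> * Re (1 / x) \<ge> 0" "\<phi> * Re q \<ge> 0"
      using nonneg inv log_deriv(1) by (auto intro!: mult_nonneg_nonneg simp del: Re_divide)
    \<comment> \<open>Five nonnegative reals with sum 0 are all 0.\<close>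
    ultimately have zero: "(\<alpha> + d * \<mu>) * Re x = 0" "\<beta> = 0" "\<gamma> * Re (1 / x) = 0"
      "\<mu> * Re D = 0" "\<phi> * Re q = 0"
      using sum0 nonneg(1) by linarith+
    have coeffs: "\<alpha> = - d * \<mu>" "\<beta> = 0" "\<gamma> = 0"
      using zero x inv by auto
    \<comment> \<open>For nonconstant \<open>P\<close> the real part of \<open>q\<close> is strictly
      positive, so \<phi> must be 0.\<close>
    have \<phi>: "\<phi> = 0 \<or> pderiv P = 0"
      using zero(5) log_deriv(2) by (auto simp: d_def pderiv_eq_0_iff)
    \<comment> \<open>If \<mu> is nonzero, then \<open>Re D = 0\<close> makes \<open>P\<close> a
      monomial, for which Euler's identity \<open>x P' = d P\<close> holds.\<close>
    have "\<mu> = 0 \<or> [:0, 1:] * pderiv P = smult (of_nat d) P"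
    proof (cases "\<mu> = 0")
      case False
      then obtain c where P_monom: "P = monom c d"
        using zero(4) log_deriv(4) by auto
      show ?thesis
        unfolding P_monom by (cases d) (simp_all add: pderiv_monom smult_monom flip: monom_Suc)
    qed simp
    \<comment> \<open>With \<beta> = \<gamma> = 0 and \<open>\<alpha> = - d * \<mu>\<close> the step
      is a combination of the Euler defect and \<open>x P'\<close>; the two preceding facts
      annihilate one summand each.\<close>
    moreover have "?S = smult (of_real \<mu>) ([:0, 0, 1:] * ([:0, 1:] * pderiv P - smult (of_nat d) P))
        + smult (of_real \<phi>) ([:0, 1:] * pderiv P)"
      by (intro poly_eq_poly_eq_iff[THEN iffD1] ext) (simp add: coeffs algebra_simps)
    ultimately show ?thesis
      using \<phi> by auto
  qed
  then show ?thesis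
    unfolding hurwitz_stable_def by blast
qed (simp add: hurwitz_stable_def)

section \<open>Passage from real to complex polynomials, and the induction\<close>

lemma map_poly_of_real_mult:
  "map_poly of_real (p * q) = (map_poly of_real p * map_poly of_real q :: 'a :: {real_algebra_1, comm_semiring_0} poly)"
  by (rule poly_eqI) (simp add: coeff_map_poly coeff_mult)

lemma map_poly_of_real_add:
  "map_poly of_real (p + q) = (map_poly of_real p + map_poly of_real q :: 'a :: {real_algebra_1, comm_semiring_0} poly)"
  by (rule poly_eqI) (simp add: coeff_map_poly)

lemma map_poly_of_real_pderiv:
  "map_poly of_real (pderiv p) = pderiv (map_poly of_real p :: 'a :: {real_algebra_1, idom} poly)"
  by (rule poly_eqI) (simp add: coeff_map_poly coeff_pderiv)

theorem theorem2p15: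
  fixes n\<^sub>0 :: nat
    and T :: "nat \<Rightarrow> real poly"
    and \<alpha> \<beta> \<gamma> \<mu> \<phi> :: "nat \<Rightarrow> real"
    and m :: "nat \<Rightarrow> nat"
  assumes rec: "\<And>n. n \<ge> n\<^sub>0 \<Longrightarrow>
      T (Suc n) = [:\<gamma> n, \<beta> n, \<alpha> n:] * T n + [:0, \<phi> n, 0, \<mu> n:] * pderiv (T n)"
    and nonneg: "\<And>n. n \<ge> n\<^sub>0 \<Longrightarrow> \<beta> n \<ge> 0 \<and> \<gamma> n \<ge> 0 \<and> \<phi> n \<ge> 0"
    and init: "hurwitz_stable (map_poly of_real (T n\<^sub>0))"
    and cases:
      "(\<forall>n\<ge>n\<^sub>0. degree (T n) = n \<and> \<alpha> n = - real n * \<mu> n \<and> - real n * \<mu> n \<ge> 0) \<or>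
       (\<forall>n\<ge>n\<^sub>0. degree (T n) = m n \<and> m n \<noteq> n \<and>
          \<alpha> n \<ge> - real (m n) * \<mu> n \<and> - real (m n) * \<mu> n \<ge> 0)"
  shows "\<forall>n\<ge>n\<^sub>0. hurwitz_stable (map_poly of_real (T n))"
proof -
  \<comment> \<open>Both alternatives give the same pair of inequalities once they are phrased with
    the actual degree of \<open>T n\<close>.\<close>
  have deg: "\<alpha> n \<ge> - real (degree (T n)) * \<mu> n" "- real (degree (T n)) * \<mu> n \<ge> 0" if "n \<ge> n\<^sub>0" for n
    using cases that by auto
  have "hurwitz_stable (map_poly of_real (T n))" if "n \<ge> n\<^sub>0" for n
    using that
  proof (induction n rule: dec_induct)
    case (step n)
    \<comment> \<open>The embedding of the reals preserves the degree, so the inequalities on the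
      coefficients carry over to the complex polynomial.\<close>
    have "hurwitz_stable ([:of_real (\<gamma> n), of_real (\<beta> n), of_real (\<alpha> n):] * map_poly of_real (T n)
        + [:0, of_real (\<phi> n), 0, of_real (\<mu> n):] * pderiv (map_poly of_real (T n)))"
      using step nonneg[of n] deg[of n]
      by (intro hurwitz_stable_step) (auto simp: degree_map_poly)
    then show ?case
      using step.hyps
      by (simp add: rec map_poly_of_real_add map_poly_of_real_mult map_poly_of_real_pderiv map_poly_pCons
          del: mult_pCons_left)
  qed (fact init)
  then show ?thesis
    by blast
qed

end
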